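(* Let $\mathcal{V}$ be a vector space over a field $\mathcal{F}$ and let $\mathcal{B}$ be a basis for $\mathcal{V}$. For each nonempty finite multiset $\mathcal{M}=\{(\xi_1,\nu_1),\ldots,(\xi_m,\nu_m)\}$, where the $\xi_j$ are distinct elements of $\mathcal{B}$ and the multiplicities $\nu_j$ are positive integers, let $\mathcal{T}_0=\{t_1,\ldots,t_K\}$ be the set of all basis monomials that correspond to $\mathcal{M}$, where $K=\binom{|\nu|}{\nu}$. Let $$\mathcal{T}=\{t_1,\;t_1-t_2,\;t_2-t_3,\;\ldots,\;t_{K-1}-t_K\}.$$ Then $\langle\mathcal{T}\rangle=\langle\mathcal{T}_0\rangle$, and if $s,t\in\mathcal{T}_0$, then $s-t\in\langle\mathcal{T}\smallsetminus\{t_1\}\rangle$. Moreover, let $\mathcal{A}$ denote the union of all the sets $\mathcal{T}\smallsetminus\{t_1\}$ (over all such multisets $\mathcal{M}$), and let $\mathcal{S}$ denote the union of all the singleton sets $\{t_1\}$ (over all such multisets $\mathcal{M}$) and $\{1\}$. Then $\mathcal{A}\cup\mathcal{S}$ is a basis for $\bigotimes\mathcal{V}$, $\mathcal{A}$ is a basis for the noncommutativity ideal $\mathcal{N}$, and $\mathcal{S}$ is a basis for a complementary subspace of $\mathcal{N}$.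
   Context: $\bigotimes\mathcal{V}=\bigoplus_{k\geqslant 0}\bigotimes^k\mathcal{V}$ is the (contravariant) tensor algebra of $\mathcal{V}$, with $\bigotimes^0\mathcal{V}=\mathcal{F}$ and $\bigotimes^1\mathcal{V}=\mathcal{V}$. $\langle\mathcal{S}\rangle$ denotes the linear span of $\mathcal{S}$. An e-product of degree $p>0$ is an element $v_1\otimes\cdots\otimes v_p$ with each $v_i\in\mathcal{V}$. A basis monomial (based on $\mathcal{B}$) is an e-product all of whose factors belong to $\mathcal{B}$; it corresponds to the multiset $\mathcal{M}=\{(\xi_1,\nu_1),\ldots,(\xi_m,\nu_m)\}$ if the $\xi_j$ are exactly its distinct factors and $\nu_j$ is the number of times $\xi_j$ appears as a factor. For $\nu=(\nu_1,\ldots,\nu_m)$, $|\nu|=\nu_1+\cdots+\nu_m$ and $\binom{|\nu|}{\nu}=|\nu|!/(\nu_1!\cdots\nu_m!)$ is the multinomial coefficient. The noncommutativity ideal $\mathcal{N}$ in $\bigotimes\mathcal{V}$ is the set of all linear combinations of differences of pairs of e-products of the same degree $p$, $p\geqslant 2$, which contain the same factors with the same multiplicities, but in different orders. *)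

theory Defs
  imports Complex_Main "HOL-Library.Poly_Mapping" "HOL-Library.Multiset"
begin

definition basis_of :: "('f::field \<Rightarrow> 'a::ab_group_add \<Rightarrow> 'a) \<Rightarrow> 'a set \<Rightarrow> 'a set \<Rightarrow> bool" where
  "basis_of scale B W \<longleftrightarrow> \<not> module.dependent scale B \<and> module.span scale B = W"

definition complementary ::
    "('f::field \<Rightarrow> 'a::ab_group_add \<Rightarrow> 'a) \<Rightarrow> 'a set \<Rightarrow> 'a set \<Rightarrow> 'a set \<Rightarrow> bool" where
  "complementary scale W N C \<longleftrightarrow>
     module.subspace scale N \<and> module.subspace scale C \<and>
     N \<inter> C = {0} \<and> {x + y |x y. x \<in> N \<and> y \<in> C} = W"


section \<open>The tensor algebra\<close>

text \<open>
  Lists form the free monoid under concatenation, so \<open>'v list \<Rightarrow>\<^sub>0 'f\<close> with the convolution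
  product of \<open>Poly_Mapping\<close> is the free unital associative \<open>'f\<close>-algebra on the set of all
  vectors, and \<open>single [v1, ..., vp] 1\<close> is the word \<open>v1 ... vp\<close>.
\<close>

instantiation list :: (type) monoid_add
begin

definition zero_list :: "'a list" where "zero_list = []"
definition plus_list :: "'a list \<Rightarrow> 'a list \<Rightarrow> 'a list" where "plus_list = (@)"

instance by standard (simp_all add: zero_list_def plus_list_def)

end

definition free_scale :: "'f::field \<Rightarrow> ('v list \<Rightarrow>\<^sub>0 'f) \<Rightarrow> ('v list \<Rightarrow>\<^sub>0 'f)" where
  "free_scale c = Poly_Mapping.map ((*) c)"

definition linearity_relations ::
    "('f::field \<Rightarrow> 'v::ab_group_add \<Rightarrow> 'v) \<Rightarrow> ('v list \<Rightarrow>\<^sub>0 'f) set" where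
  "linearity_relations scaleV =
     {Poly_Mapping.single [u + v] 1 - Poly_Mapping.single [u] 1 - Poly_Mapping.single [v] 1 |u v. True}
     \<union> {Poly_Mapping.single [scaleV c v] 1 - Poly_Mapping.single [v] c |c v. True}"

text \<open>The two-sided ideal generated by the linearity relations.\<close>

definition tensor_ideal ::
    "('f::field \<Rightarrow> 'v::ab_group_add \<Rightarrow> 'v) \<Rightarrow> ('v list \<Rightarrow>\<^sub>0 'f) set" where
  "tensor_ideal scaleV =
     module.span free_scale {a * g * b |a g b. g \<in> linearity_relations scaleV}"

text \<open>
  With \<open>\<iota>\<close> the embedding of the vectors into the algebra, \<open>eprod \<iota> [v1, ..., vp]\<close> is the e-product
  of \<open>v1, ..., vp\<close> (and \<open>1\<close> for the empty list).
\<close>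

definition eprod :: "('v \<Rightarrow> 'a::ring_1) \<Rightarrow> 'v list \<Rightarrow> 'a" where
  "eprod \<iota> w = prod_list (map \<iota> w)"

definition free_eval ::
    "('f::field \<Rightarrow> 'a::ring_1 \<Rightarrow> 'a) \<Rightarrow> ('v \<Rightarrow> 'a) \<Rightarrow> ('v list \<Rightarrow>\<^sub>0 'f) \<Rightarrow> 'a" where
  "free_eval scaleA \<iota> x =
     (\<Sum>w\<in>Poly_Mapping.keys x. scaleA (Poly_Mapping.lookup x w) (eprod \<iota> w))"

locale algebra_over = vector_space scaleA
  for scaleA :: "'f::field \<Rightarrow> 'a::ring_1 \<Rightarrow> 'a" +
  assumes scale_mult_left: "scaleA c (x * y) = scaleA c x * y"
    and scale_mult_right: "scaleA c (x * y) = x * scaleA c y"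

text \<open>
  \<open>T\<close>, a unital subalgebra of some ambient algebra, together with \<open>\<iota>\<close> is a tensor algebra of the
  vector space given by \<open>scaleV\<close>: the homomorphism from the free algebra induced by \<open>\<iota>\<close> is onto
  \<open>T\<close> and its kernel is exactly the ideal generated by the linearity relations. That \<open>T\<close> need not
  be a whole type is what makes \<open>tensor_algebra_exists\<close> below provable for every vector space.
\<close>

locale tensor_algebra = V: vector_space scaleV + A: algebra_over scaleA
  for scaleV :: "'f::field \<Rightarrow> 'v::ab_group_add \<Rightarrow> 'v"
    and scaleA :: "'f \<Rightarrow> 'a::ring_1 \<Rightarrow> 'a" +
  fixes T :: "'a set" and \<iota> :: "'v \<Rightarrow> 'a"
  assumes range_eval: "range (free_eval scaleA \<iota> :: ('v list \<Rightarrow>\<^sub>0 'f) \<Rightarrow> 'a) = T"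
    and kernel_eval: "{x. free_eval scaleA \<iota> x = 0} = tensor_ideal scaleV"

subsection \<open>Existence and universal property\<close>

lemma free_scale_conv: "free_scale c x = Poly_Mapping.single [] c * x"
  using mult_map_scale_conv_mult[of c x] by (simp add: free_scale_def zero_list_def)

lemma lookup_free_scale [simp]:
  "Poly_Mapping.lookup (free_scale c x) w = c * Poly_Mapping.lookup x w"
  unfolding free_scale_def by transfer (simp add: when_def)

lemma word_mult:
  fixes c d :: "'f::field"
  shows "Poly_Mapping.single u c * Poly_Mapping.single w d = Poly_Mapping.single (u @ w) (c * d)"
  by (simp add: mult_single plus_list_def)

lemma word_decomp:
  fixes x :: "'v list \<Rightarrow>\<^sub>0 'f::field"
  shows "x = (\<Sum>w\<in>Poly_Mapping.keys x. Poly_Mapping.single w (Poly_Mapping.lookup x w))"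
  by (rule poly_mapping_eqI)
     (simp add: lookup_sum lookup_single when_def in_keys_iff)

lemma free_induct [case_names word add]:
  fixes x :: "'v list \<Rightarrow>\<^sub>0 'f::field"
  assumes w: "\<And>w c. P (Poly_Mapping.single w c)" and a: "\<And>x y. P x \<Longrightarrow> P y \<Longrightarrow> P (x + y)"
  shows "P x"
proof -
  have "P (\<Sum>w\<in>W. Poly_Mapping.single w (Poly_Mapping.lookup x w))" if "finite W" for W
    using that
  proof induction
    case empty
    show ?case using w[of "[]" 0] by simp
  qed (simp add: w a)
  from this[OF finite_keys[of x]] show ?thesis by (simp flip: word_decomp)
qed

lemma algebra_free: "algebra_over (free_scale :: 'f::field \<Rightarrow> ('v list \<Rightarrow>\<^sub>0 'f) \<Rightarrow> _)"
proof
  fix c d :: 'f and x y :: "'v list \<Rightarrow>\<^sub>0 'f"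
  show "free_scale c (x + y) = free_scale c x + free_scale c y"
    by (simp add: free_scale_conv distrib_left)
  show "free_scale (c + d) x = free_scale c x + free_scale d x"
    by (simp add: free_scale_conv single_add distrib_right)
  show "free_scale c (free_scale d x) = free_scale (c * d) x"
    by (simp add: free_scale_conv word_mult mult.assoc[symmetric])
  show "free_scale 1 x = x"
    by (rule poly_mapping_eqI) simp
  show "free_scale c (x * y) = free_scale c x * y"
    by (simp add: free_scale_conv mult.assoc)
  have central: "Poly_Mapping.single [] c * x = x * Poly_Mapping.single [] c"
    by (induction x rule: free_induct) (simp_all add: word_mult mult.commute distrib_left distrib_right)
  show "free_scale c (x * y) = x * free_scale c y"
    by (simp add: free_scale_conv central flip: mult.assoc)
qed

interpretation free: algebra_over "free_scale :: 'f::field \<Rightarrow> ('v list \<Rightarrow>\<^sub>0 'f) \<Rightarrow> _"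
  by (rule algebra_free)

lemma tensor_ideal_mult:
  assumes "x \<in> tensor_ideal scaleV"
  shows "p * x * q \<in> tensor_ideal scaleV"
  using assms unfolding tensor_ideal_def
proof (induction rule: free.span_induct_alt)
  case base
  show ?case by (simp add: free.span_zero)
next
  case (step c y z)
  from step(1) obtain a g b where y: "y = a * g * b" and g: "g \<in> linearity_relations scaleV"
    by blast
  have "p * y * q = (p * a) * g * (b * q)" by (simp add: y mult.assoc)
  then have "p * y * q \<in> free.span {a * g * b |a g b. g \<in> linearity_relations scaleV}"
    using g by (auto intro!: free.span_base)
  moreover have "p * (free_scale c y + z) * q = free_scale c (p * y * q) + p * z * q"
    by (simp add: distrib_left distrib_right flip: free.scale_mult_left free.scale_mult_right)
  ultimately show ?case using step(2)
    by (simp add: free.span_add free.span_scale)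
qed

context algebra_over
begin

lemma free_eval_single [simp]: "free_eval scaleA f (Poly_Mapping.single w c) = scaleA c (eprod f w)"
  by (simp add: free_eval_def)

lemma free_eval_add: "free_eval scaleA f (x + y) = free_eval scaleA f x + free_eval scaleA f y"
  unfolding free_eval_def
  by (rule setsum_keys_plus_distrib) (simp_all add: scale_left_distrib)

lemma free_eval_mult: "free_eval scaleA f (x * y) = free_eval scaleA f x * free_eval scaleA f y"
proof (induction x rule: free_induct)
  case (word u c)
  show ?case
  proof (induction y rule: free_induct)
    case (word w d)
    then show ?case
      by (simp add: word_mult eprod_def scale_mult_left[symmetric] scale_mult_right[symmetric] mult.commute)
  qed (simp add: distrib_left free_eval_add)
qed (simp add: distrib_right free_eval_add)

lemma free_eval_scale: "free_eval scaleA f (free_scale c x) = scaleA c (free_eval scaleA f x)"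
  by (simp add: free_scale_conv free_eval_mult eprod_def scale_mult_left[symmetric])

lemma free_eval_minus: "free_eval scaleA f (x - y) = free_eval scaleA f x - free_eval scaleA f y"
  using free_eval_add[of f "x - y" y] by simp

lemma tensor_ideal_kernel:
  assumes lin: "Vector_Spaces.linear scaleV scaleA f" and x: "x \<in> tensor_ideal scaleV"
  shows "free_eval scaleA f x = 0"
  using x unfolding tensor_ideal_def
proof (induction rule: free.span_induct_alt)
  case base
  show ?case by (simp add: free_eval_def)
next
  case (step c y z)
  from step(1) obtain a g b where y: "y = a * g * b" and g: "g \<in> linearity_relations scaleV"
    by blast
  interpret f: Vector_Spaces.linear scaleV scaleA f by fact
  have "free_eval scaleA f g = 0"
    using g by (auto simp: linearity_relations_def free_eval_minus eprod_def f.add f.scale)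
  then show ?case using step(2) by (simp add: y free_eval_add free_eval_scale free_eval_mult)
qed

end

theorem tensor_algebra_exists:
  fixes scaleV :: "'f::field \<Rightarrow> 'v::ab_group_add \<Rightarrow> 'v"
  assumes "vector_space scaleV"
  shows "\<exists>T (\<iota> :: 'v \<Rightarrow> 'v list \<Rightarrow>\<^sub>0 'f). tensor_algebra scaleV free_scale T \<iota>"
proof -
  interpret V: vector_space scaleV by fact
  interpret VF: vector_space_pair scaleV "free_scale :: 'f \<Rightarrow> ('v list \<Rightarrow>\<^sub>0 'f) \<Rightarrow> _"
    by (intro vector_space_pair.intro V.vector_space_axioms free.vector_space_axioms)
  obtain B where B: "V.independent B" "V.span B = UNIV"
    using V.maximal_independent_subset[of UNIV] by (metis top.extremum_uniqueI)
  obtain \<iota> :: "'v \<Rightarrow> 'v list \<Rightarrow>\<^sub>0 'f" where lin: "Vector_Spaces.linear scaleV free_scale \<iota>"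
    and \<iota>: "\<And>b. b \<in> B \<Longrightarrow> \<iota> b = Poly_Mapping.single [b] 1"
    using VF.linear_independent_extend[OF B(1), of "\<lambda>b. Poly_Mapping.single [b] 1"] by blast
  interpret \<iota>: Vector_Spaces.linear scaleV "free_scale :: 'f \<Rightarrow> ('v list \<Rightarrow>\<^sub>0 'f) \<Rightarrow> _" \<iota> by fact
  let ?R = "tensor_ideal scaleV"
  have sub: "free.subspace ?R" unfolding tensor_ideal_def by (rule free.subspace_span)
  have rel: "g \<in> ?R" if "g \<in> linearity_relations scaleV" for g
  proof -
    have "g = 1 * g * 1" by simp
    then show ?thesis unfolding tensor_ideal_def using that by (blast intro: free.span_base)
  qed
  have plus: "x + y \<in> ?R" if "x \<in> ?R" "y \<in> ?R" for x y
    using free.subspace_add[OF sub] that by blast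
  have left: "p * x \<in> ?R" if "x \<in> ?R" for p x
    using tensor_ideal_mult[OF that, of p 1] by simp
  have right: "x * q \<in> ?R" if "x \<in> ?R" for x q
    using tensor_ideal_mult[OF that, of 1 q] by simp
  have zero: "0 \<in> ?R" using free.subspace_0[OF sub] .
  have vec: "Poly_Mapping.single [v] 1 - \<iota> v \<in> ?R" for v
  proof -
    have "v \<in> V.span B" using B(2) by simp
    then show ?thesis
    proof (induction rule: V.span_induct_alt)
      case base
      have "Poly_Mapping.single [scaleV 0 0] 1 - Poly_Mapping.single [0] 0 \<in> linearity_relations scaleV"
        unfolding linearity_relations_def by blast
      then show ?case using rel by (simp add: \<iota>.zero)
    next
      case (step c b y)
      let ?s = "\<lambda>v a. Poly_Mapping.single [v] a"
      have 1: "?s (scaleV c b + y) 1 - ?s (scaleV c b) 1 - ?s y 1 \<in> ?R"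
        by (rule rel) (auto simp: linearity_relations_def)
      have 2: "?s (scaleV c b) 1 - ?s b c \<in> ?R"
        by (rule rel) (auto simp: linearity_relations_def)
      have 3: "\<iota> (scaleV c b + y) = ?s b c + \<iota> y"
        using step(1) by (simp add: \<iota>.add \<iota>.scale \<iota> free_scale_conv word_mult)
      show ?case unfolding 3 using plus[OF plus[OF 1 2] step(2)] by (simp add: algebra_simps)
    qed
  qed
  have words: "Poly_Mapping.single w 1 - eprod \<iota> w \<in> ?R" for w
  proof (induction w)
    case Nil
    have "Poly_Mapping.single [] (1::'f) = (1 :: 'v list \<Rightarrow>\<^sub>0 'f)"
      by (simp flip: zero_list_def)
    then show ?case using zero by (simp add: eprod_def)
  next
    case (Cons v w)
    have "Poly_Mapping.single (v # w) 1 - eprod \<iota> (v # w) =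
        (Poly_Mapping.single [v] 1 - \<iota> v) * Poly_Mapping.single w 1
        + \<iota> v * (Poly_Mapping.single w 1 - eprod \<iota> w)"
      by (simp add: eprod_def algebra_simps word_mult)
    then show ?case using plus[OF right[OF vec] left[OF Cons]] by simp
  qed
  have "x - free_eval free_scale \<iota> x \<in> ?R" for x
  proof (induction x rule: free_induct)
    case (word w c)
    have "Poly_Mapping.single w c - free_eval free_scale \<iota> (Poly_Mapping.single w c) =
       Poly_Mapping.single [] c * (Poly_Mapping.single w 1 - eprod \<iota> w)"
      unfolding free.free_eval_single by (simp add: free_scale_conv right_diff_distrib word_mult)
    then show ?case using left[OF words] by simp
  next
    case (add x y)
    show ?case using plus[OF add] by (simp add: free.free_eval_add algebra_simps)
  qed
  then have "x \<in> ?R" if "free_eval free_scale \<iota> x = 0" for x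
    using that by (metis diff_zero)
  then have "{x. free_eval free_scale \<iota> x = 0} = ?R"
    using free.tensor_ideal_kernel[OF lin] by blast
  then have "tensor_algebra scaleV free_scale (range (free_eval free_scale \<iota>)) \<iota>"
    by unfold_locales simp_all
  then show ?thesis by blast
qed

theorem (in tensor_algebra) universal_property:
  fixes scaleC :: "'f \<Rightarrow> 'c::ring_1 \<Rightarrow> 'c"
  assumes "algebra_over scaleC" and lin: "Vector_Spaces.linear scaleV scaleC f"
  shows "\<exists>\<phi>. (\<forall>v. \<phi> (\<iota> v) = f v) \<and> \<phi> 1 = 1 \<and>
      (\<forall>x\<in>T. \<forall>y\<in>T. \<phi> (x + y) = \<phi> x + \<phi> y \<and> \<phi> (x * y) = \<phi> x * \<phi> y) \<and>
      (\<forall>c. \<forall>x\<in>T. \<phi> (scaleA c x) = scaleC c (\<phi> x))"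
proof -
  interpret C: algebra_over scaleC by fact
  let ?e = "free_eval scaleA \<iota> :: ('v list \<Rightarrow>\<^sub>0 'f) \<Rightarrow> 'a" and ?h = "free_eval scaleC f"
  define \<phi> where "\<phi> = (\<lambda>z. ?h (SOME x. ?e x = z))"
  have \<phi>: "\<phi> (?e x) = ?h x" for x
  proof -
    define x' where "x' = (SOME y. ?e y = ?e x)"
    have "?e x' = ?e x" unfolding x'_def by (rule someI) (rule refl)
    then have "x' - x \<in> {x. ?e x = 0}" by (simp add: A.free_eval_minus)
    then have "x' - x \<in> tensor_ideal scaleV" unfolding kernel_eval .
    from C.tensor_ideal_kernel[OF lin this] show ?thesis
      by (simp add: \<phi>_def C.free_eval_minus flip: x'_def)
  qed
  have T: "z \<in> T \<longleftrightarrow> (\<exists>x. z = ?e x)" for z using range_eval by blast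
  have "\<phi> (\<iota> v) = f v" for v
    using \<phi>[of "Poly_Mapping.single [v] 1"] by (simp add: eprod_def)
  moreover have "\<phi> 1 = 1"
    using \<phi>[of "Poly_Mapping.single [] 1"] by (simp add: eprod_def)
  moreover have "\<phi> (x + y) = \<phi> x + \<phi> y \<and> \<phi> (x * y) = \<phi> x * \<phi> y" if "x \<in> T" "y \<in> T" for x y
  proof -
    obtain p q where "x = ?e p" "y = ?e q" using \<open>x \<in> T\<close> \<open>y \<in> T\<close> T by blast
    then show ?thesis
      using \<phi>[of p] \<phi>[of q] \<phi>[of "p + q"] \<phi>[of "p * q"]
      by (simp add: A.free_eval_add A.free_eval_mult C.free_eval_add C.free_eval_mult)
  qed
  moreover have "\<phi> (scaleA c x) = scaleC c (\<phi> x)" if "x \<in> T" for c x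
  proof -
    obtain p where "x = ?e p" using \<open>x \<in> T\<close> T by blast
    then show ?thesis
      using \<phi>[of p] \<phi>[of "free_scale c p"]
      by (simp add: A.free_eval_scale C.free_eval_scale)
  qed
  ultimately show ?thesis by blast
qed


section \<open>Basis monomials and the noncommutativity ideal\<close>

definition basis_multisets :: "'v set \<Rightarrow> 'v multiset set" where
  "basis_multisets B = {M. M \<noteq> {#} \<and> set_mset M \<subseteq> B}"

definition basis_monomials :: "('v \<Rightarrow> 'a::ring_1) \<Rightarrow> 'v set \<Rightarrow> 'v multiset \<Rightarrow> 'a set" where
  "basis_monomials \<iota> B M = {eprod \<iota> w |w. set w \<subseteq> B \<and> mset w = M}"

definition difference_chain :: "(nat \<Rightarrow> 'a::ab_group_add) \<Rightarrow> nat \<Rightarrow> 'a set" where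
  "difference_chain t K = {t 1} \<union> {t i - t (i + 1) |i. 1 \<le> i \<and> i < K}"

definition multinomial_mset :: "'v multiset \<Rightarrow> nat" where
  "multinomial_mset M = fact (size M) div (\<Prod>x\<in>set_mset M. fact (count M x))"

definition noncomm_ideal ::
    "('f::field \<Rightarrow> 'a::ring_1 \<Rightarrow> 'a) \<Rightarrow> ('v \<Rightarrow> 'a) \<Rightarrow> 'a set" where
  "noncomm_ideal scaleA \<iota> =
     module.span scaleA
       {eprod \<iota> u - eprod \<iota> w |u w. length u = length w \<and> length u \<ge> 2 \<and> mset u = mset w \<and> u \<noteq> w}"

end

theory Submission
  imports Defs "HOL-Combinatorics.Multiset_Permutations"
begin

text \<open>
  Write \<open>e w\<close> for the e-product \<open>eprod \<iota> w\<close> of a word \<open>w\<close>. Everything rests on the fact that the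
  products \<open>e w\<close>, for words \<open>w\<close> over the basis \<open>B\<close>, are pairwise distinct and form a basis of the
  tensor algebra. They span because \<open>\<iota>\<close> is linear. For independence, suppose that a combination
  \<open>x\<close> of words over \<open>B\<close> is sent to \<open>0\<close>. Then \<open>x\<close> lies in the ideal of the linearity relations,
  so every algebra map induced by a linear map out of the vector space kills it
  (\<open>free_eval_basis_words_eq_0\<close>). The linear map into the free algebra that sends each \<open>b \<in> B\<close>
  to the one-letter word \<open>b\<close> induces an algebra map that fixes \<open>x\<close>; hence \<open>x = 0\<close>.

  The words over \<open>B\<close> split into classes of equal multiset, and the passage from
  \<open>t 1, \<dots>, t K\<close> to \<open>t 1, t 1 - t 2, \<dots>, t (K - 1) - t K\<close> is a change of basis within each class.
  Spans are compared by telescoping. Independence of the new family (\<open>independent\<close>) is shown by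
  separating functionals, which can be prescribed freely on the \<open>t j\<close> (\<open>functional_exists\<close>): the
  indicator of \<open>{j. j > i}\<close> in one class is nonzero on \<open>t i - t (i + 1)\<close> and vanishes on
  all other members of the family, and the indicator of a whole class does the same for its \<open>t 1\<close>.

  Finally, the noncommutativity ideal is generated by differences of reorderings of e-products of
  arbitrary vectors, whereas the differences in the chains only involve vectors of \<open>B\<close>. The two
  spans agree because \<open>e u - e w\<close> is linear in each factor that \<open>u\<close> and \<open>w\<close> share, so that the
  factors can be expanded in \<open>B\<close> one at a time (\<open>reordering_in_subspace\<close>). A basis that is the
  disjoint union of two sets splits the space into their spans, which gives the complement.
\<close>

section \<open>Linear algebra\<close>

context vector_space
begin

text \<open>
  The condition speaks of the elements of \<open>X\<close> as a set, so in a parametrised family no injectivity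
  of the parametrisation has to be established first.
\<close>

lemma independent_if_separated:
  assumes sep: "\<And>z. z \<in> X \<Longrightarrow>
      \<exists>\<phi>. Vector_Spaces.linear scale (*) \<phi> \<and> \<phi> z \<noteq> 0 \<and> (\<forall>y\<in>X - {z}. \<phi> y = 0)"
  shows "independent X"
proof
  assume "dependent X"
  then obtain z where z: "z \<in> X" "z \<in> span (X - {z})"
    unfolding dependent_def by blast
  obtain \<phi> where "Vector_Spaces.linear scale (*) \<phi>" and nz: "\<phi> z \<noteq> 0"
    and rest: "\<And>y. y \<in> X - {z} \<Longrightarrow> \<phi> y = 0"
    using sep[OF z(1)] by blast
  then interpret \<phi>: Vector_Spaces.linear scale "(*)" \<phi> by blast
  from z(2) have "\<phi> z = 0"
    by (induction rule: span_induct_alt) (simp_all add: \<phi>.add \<phi>.scale \<phi>.zero rest)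
  with nz show False by simp
qed

text \<open>
  The coordinates of a common element with respect to \<open>X \<union> Y\<close> are supported both in \<open>X\<close> and in
  \<open>Y\<close>, hence nowhere.
\<close>

lemma span_Int_span_of_disjoint:
  assumes ind: "independent (X \<union> Y)" and disj: "X \<inter> Y = {}"
  shows "span X \<inter> span Y = {0}"
proof
  show "span X \<inter> span Y \<subseteq> {0}"
  proof
    fix x assume "x \<in> span X \<inter> span Y"
    then have x: "x \<in> span X" "x \<in> span Y" by auto
    have "representation X x = representation Y x"
      using representation_extend[OF ind x(1)] representation_extend[OF ind x(2)] by simp
    then have "representation X x v = 0" for v
      using representation_ne_zero[of X x v] representation_ne_zero[of Y x v] disj by force
    moreover have "(\<Sum>v | representation X x v \<noteq> 0. representation X x v *s v) = x"
      using x(1) by (intro sum_nonzero_representation_eq) (use ind independent_mono in blast)+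
    ultimately show "x \<in> {0}" by simp
  qed
qed (auto simp: span_zero)

lemma span_telescope:
  assumes "\<And>i. 1 \<le> i \<Longrightarrow> i < K \<Longrightarrow> f i - f (Suc i) \<in> span X" and "i \<in> {1..K}"
  shows "f 1 - f i \<in> span X"
proof -
  have "1 \<le> i" "i \<le> K" using assms(2) by auto
  then show ?thesis
  proof (induction i rule: dec_induct)
    case base
    show ?case by (simp add: span_zero)
  next
    case (step i)
    then have "(f 1 - f i) + (f i - f (Suc i)) \<in> span X"
      by (intro span_add assms(1)) auto
    then show ?case by simp
  qed
qed

end

lemma (in algebra_over) span_mult:
  assumes "x \<in> span X" and "y \<in> span Y"
  shows "x * y \<in> span {a * b |a b. a \<in> X \<and> b \<in> Y}" (is "_ \<in> span ?P")
  using assms(1)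
proof (induction rule: span_induct_alt)
  case base
  show ?case by (simp add: span_zero)
next
  case (step c a x)
  from assms(2) have "a * y \<in> span ?P"
  proof (induction rule: span_induct_alt)
    case base
    show ?case by (simp add: span_zero)
  next
    case (step d b y)
    have "a * b \<in> span ?P" using \<open>a \<in> X\<close> step by (auto intro: span_base)
    then show ?case using step
      by (simp add: distrib_left scale_mult_right[symmetric] span_add span_scale)
  qed
  then show ?case using step
    by (simp add: distrib_right scale_mult_left[symmetric] span_add span_scale)
qed

section \<open>E-products of basis vectors form a basis\<close>

context tensor_algebra
begin

text \<open>
  Linearity of \<open>\<iota>\<close> is encoded in the kernel of the evaluation map, which contains the linearity
  relations.
\<close>

lemma linear_\<iota>: "Vector_Spaces.linear scaleV scaleA \<iota>"
proof -
  have vanish: "free_eval scaleA \<iota> g = 0" if "g \<in> linearity_relations scaleV" for g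
  proof -
    have "g = 1 * g * 1" by simp
    with that have "g \<in> tensor_ideal scaleV"
      unfolding tensor_ideal_def by (blast intro: free.span_base)
    then show ?thesis using kernel_eval by blast
  qed
  have "\<iota> (u + v) = \<iota> u + \<iota> v" for u v
  proof -
    have "free_eval scaleA \<iota> (Poly_Mapping.single [u + v] 1 - Poly_Mapping.single [u] 1
        - Poly_Mapping.single [v] 1) = 0"
      by (rule vanish) (auto simp: linearity_relations_def)
    then show ?thesis by (simp add: A.free_eval_minus A.free_eval_add eprod_def diff_diff_eq)
  qed
  moreover have "\<iota> (scaleV c v) = scaleA c (\<iota> v)" for c v
  proof -
    have "free_eval scaleA \<iota> (Poly_Mapping.single [scaleV c v] 1 - Poly_Mapping.single [v] c) = 0"
      by (rule vanish) (auto simp: linearity_relations_def)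
    then show ?thesis by (simp add: A.free_eval_minus eprod_def)
  qed
  ultimately show ?thesis by unfold_locales auto
qed

text \<open>
  The kernel of the evaluation map is the same for every tensor algebra. It is therefore tested
  against the linear map \<open>f\<close> into the free algebra itself with \<open>f b = b\<close> on \<open>B\<close>, for which
  evaluation is the identity on words over \<open>B\<close>.
\<close>

lemma free_eval_basis_words_eq_0:
  assumes ind: "V.independent B" and words: "\<And>w. w \<in> Poly_Mapping.keys x \<Longrightarrow> set w \<subseteq> B"
    and "free_eval scaleA \<iota> x = 0"
  shows "x = 0"
proof -
  interpret VF: vector_space_pair scaleV "free_scale :: 'f \<Rightarrow> ('v list \<Rightarrow>\<^sub>0 'f) \<Rightarrow> _"
    by (intro vector_space_pair.intro V.vector_space_axioms free.vector_space_axioms)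
  obtain f :: "'v \<Rightarrow> 'v list \<Rightarrow>\<^sub>0 'f" where lin: "Vector_Spaces.linear scaleV free_scale f"
    and f: "\<And>b. b \<in> B \<Longrightarrow> f b = Poly_Mapping.single [b] 1"
    using VF.linear_independent_extend[OF ind, of "\<lambda>b. Poly_Mapping.single [b] 1"] by blast
  have word: "eprod f w = Poly_Mapping.single w 1" if "set w \<subseteq> B" for w
    using that
  proof (induction w)
    case Nil
    show ?case using single_one[where ?'a = "'v list" and ?'b = 'f] by (simp add: eprod_def zero_list_def)
  next
    case (Cons b w)
    then show ?case by (simp add: eprod_def f word_mult)
  qed
  have "free_eval free_scale f x =
      (\<Sum>w\<in>Poly_Mapping.keys x. Poly_Mapping.single w (Poly_Mapping.lookup x w))"
    unfolding free_eval_def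
    by (intro sum.cong refl) (simp add: word words free_scale_conv word_mult)
  also have "\<dots> = x" by (rule word_decomp[symmetric])
  finally have "free_eval free_scale f x = x" .
  moreover have "x \<in> tensor_ideal scaleV" using assms(3) kernel_eval by blast
  ultimately show ?thesis using free.tensor_ideal_kernel[OF lin] by metis
qed

lemma inj_on_eprod:
  assumes "V.independent B"
  shows "inj_on (eprod \<iota>) {w. set w \<subseteq> B}"
proof (rule inj_onI)
  fix u w assume uw: "u \<in> {w. set w \<subseteq> B}" "w \<in> {w. set w \<subseteq> B}" and eq: "eprod \<iota> u = eprod \<iota> w"
  let ?x = "Poly_Mapping.single u (1::'f) - Poly_Mapping.single w 1"
  have "Poly_Mapping.keys ?x \<subseteq> {u, w}"
    by (auto simp: in_keys_iff lookup_minus lookup_single when_def split: if_splits)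
  with uw have "?x = 0"
    by (intro free_eval_basis_words_eq_0[OF assms]) (auto simp: A.free_eval_minus eq)
  then have "Poly_Mapping.lookup (Poly_Mapping.single u (1::'f)) u =
      Poly_Mapping.lookup (Poly_Mapping.single w 1) u"
    by simp
  then show "u = w" by (simp add: lookup_single when_def split: if_splits)
qed

lemma independent_eprod:
  assumes "V.independent B"
  shows "A.independent (eprod \<iota> ` {w. set w \<subseteq> B})"
  unfolding A.independent_explicit_finite_subsets
proof (intro allI impI ballI)
  fix E c e
  assume E: "E \<subseteq> eprod \<iota> ` {w. set w \<subseteq> B}" "finite E"
    and zero: "(\<Sum>v\<in>E. scaleA (c v) v) = 0" and e: "e \<in> E"
  obtain W where W: "W \<subseteq> {w. set w \<subseteq> B}" "inj_on (eprod \<iota>) W" "E = eprod \<iota> ` W"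
    using E(1) unfolding subset_image_inj by auto
  have fin: "finite W" using E(2) W(2,3) by (simp add: finite_image_iff)
  define x where "x = (\<Sum>w\<in>W. Poly_Mapping.single w (c (eprod \<iota> w)))"
  have lookup: "Poly_Mapping.lookup x w = (if w \<in> W then c (eprod \<iota> w) else 0)" for w
    using fin by (simp add: x_def lookup_sum lookup_single when_def)
  have "free_eval scaleA \<iota> x = (\<Sum>w\<in>W. scaleA (c (eprod \<iota> w)) (eprod \<iota> w))"
    unfolding x_def using fin
    by (induction W) (simp_all add: A.free_eval_add, simp add: free_eval_def)
  also have "\<dots> = 0" using zero W by (simp add: sum.reindex)
  finally have "x = 0"
    using W(1) by (intro free_eval_basis_words_eq_0[OF assms])
      (auto simp: in_keys_iff lookup split: if_splits)
  moreover obtain w where "w \<in> W" "e = eprod \<iota> w" using e W(3) by blast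
  ultimately show "c e = 0" using lookup[of w] by simp
qed

lemma eprod_in_span_basis_words:
  assumes "V.span B = UNIV"
  shows "eprod \<iota> w \<in> A.span (eprod \<iota> ` {w. set w \<subseteq> B})"
proof (induction w)
  case Nil
  show ?case by (intro A.span_base) auto
next
  case (Cons v w)
  interpret \<iota>: Vector_Spaces.linear scaleV scaleA \<iota> by (rule linear_\<iota>)
  have "\<iota> v \<in> A.span (\<iota> ` B)"
    using \<iota>.span_image[of B] assms by auto
  from A.span_mult[OF this Cons]
  have "eprod \<iota> (v # w) \<in>
      A.span {a * b |a b. a \<in> \<iota> ` B \<and> b \<in> eprod \<iota> ` {w. set w \<subseteq> B}}"
    by (simp add: eprod_def)
  moreover have "{a * b |a b. a \<in> \<iota> ` B \<and> b \<in> eprod \<iota> ` {w. set w \<subseteq> B}}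
      \<subseteq> eprod \<iota> ` {w. set w \<subseteq> B}"
  proof clarify
    fix b w assume "b \<in> B" "set w \<subseteq> B"
    then show "\<iota> b * eprod \<iota> w \<in> eprod \<iota> ` {w. set w \<subseteq> B}"
      by (intro image_eqI[of _ _ "b # w"]) (simp_all add: eprod_def)
  qed
  ultimately show ?case using A.span_mono by blast
qed

lemma span_basis_words:
  assumes "V.span B = UNIV"
  shows "A.span (eprod \<iota> ` {w. set w \<subseteq> B}) = T" (is "?S = T")
proof
  have "eprod \<iota> w \<in> T" for w
    using range_eval A.free_eval_single[of \<iota> w 1] by (metis A.scale_one rangeI)
  moreover have "A.subspace T"
  proof (rule A.subspaceI)
    show "0 \<in> T" using range_eval by (metis A.free_eval_minus cancel_comm_monoid_add_class.diff_cancel rangeI)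
    show "x + y \<in> T" if "x \<in> T" "y \<in> T" for x y
      using that unfolding range_eval[symmetric] by (auto simp flip: A.free_eval_add)
    show "scaleA c x \<in> T" if "x \<in> T" for c x
      using that unfolding range_eval[symmetric] by (auto simp flip: A.free_eval_scale)
  qed
  ultimately show "?S \<subseteq> T" by (intro A.span_minimal) auto
  show "T \<subseteq> ?S"
    unfolding range_eval[symmetric] free_eval_def
    using eprod_in_span_basis_words[OF assms] by (auto intro: A.span_sum A.span_scale)
qed

text \<open>
  Induction on the number of factors outside \<open>B\<close>. A factor \<open>v \<notin> B\<close> of \<open>u\<close> also occurs in \<open>w\<close>, and
  the difference is linear in \<open>v\<close> when both occurrences vary together. So it suffices to treat
  \<open>v \<in> B\<close>, where the words are again reorderings of each other and fewer factors lie outside \<open>B\<close>.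
\<close>

lemma reordering_in_subspace:
  assumes span: "V.span B = UNIV" and sub: "A.subspace D"
    and basis: "\<And>u w. set u \<subseteq> B \<Longrightarrow> set w \<subseteq> B \<Longrightarrow> mset u = mset w \<Longrightarrow> eprod \<iota> u - eprod \<iota> w \<in> D"
    and "mset u = mset w"
  shows "eprod \<iota> u - eprod \<iota> w \<in> D"
  using assms(4)
proof (induction "size (filter_mset (\<lambda>v. v \<notin> B) (mset u))" arbitrary: u w rule: less_induct)
  case less
  interpret \<iota>: Vector_Spaces.linear scaleV scaleA \<iota> by (rule linear_\<iota>)
  show ?case
  proof (cases "set u \<subseteq> B")
    case True
    with less.prems show ?thesis by (intro basis) (auto dest: mset_eq_setD)
  next
    case False
    then obtain v where v: "v \<in> set u" "v \<notin> B" by blast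
    have "v \<in> set w" using v less.prems mset_eq_setD by metis
    with v obtain u1 u2 w1 w2 where uw: "u = u1 @ v # u2" "w = w1 @ v # w2"
      by (meson split_list)
    have "x \<in> V.span B" for x using span by simp
    then have "eprod \<iota> (u1 @ x # u2) - eprod \<iota> (w1 @ x # w2) \<in> D" for x
    proof (induction x rule: V.span_induct_alt)
      case base
      show ?case using A.subspace_0[OF sub] by (simp add: eprod_def \<iota>.zero)
    next
      case (step c b y)
      have "eprod \<iota> (u1 @ b # u2) - eprod \<iota> (w1 @ b # w2) \<in> D"
        by (rule less.hyps) (use less.prems v(2) step(1) uw in simp_all)
      then have "scaleA c (eprod \<iota> (u1 @ b # u2) - eprod \<iota> (w1 @ b # w2))
          + (eprod \<iota> (u1 @ y # u2) - eprod \<iota> (w1 @ y # w2)) \<in> D"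
        using step(2) sub by (intro A.subspace_add A.subspace_scale)
      moreover have "eprod \<iota> (p @ (scaleV c b + y) # q) =
          scaleA c (eprod \<iota> (p @ b # q)) + eprod \<iota> (p @ y # q)" for p q
        by (simp add: eprod_def \<iota>.add \<iota>.scale distrib_left distrib_right
            flip: A.scale_mult_left A.scale_mult_right)
      ultimately show ?case by (simp add: A.scale_right_diff_distrib algebra_simps)
    qed
    then show ?thesis unfolding uw by simp
  qed
qed

end

section \<open>Chains of differences of basis monomials\<close>

locale enumerated_monomials = tensor_algebra scaleV scaleA TV \<iota>
  for scaleV :: "'f::field \<Rightarrow> 'v::ab_group_add \<Rightarrow> 'v"
    and scaleA :: "'f \<Rightarrow> 'a::ring_1 \<Rightarrow> 'a" and TV \<iota> +
  fixes B :: "'v set" and K :: "'v multiset \<Rightarrow> nat" and t :: "'v multiset \<Rightarrow> nat \<Rightarrow> 'a"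
  assumes basis: "basis_of scaleV B UNIV"
    and enum: "M \<in> basis_multisets B \<Longrightarrow> bij_betw (t M) {1..K M} (basis_monomials \<iota> B M)"
begin

lemma independent_B: "V.independent B" and span_B: "V.span B = UNIV"
  using basis by (auto simp: basis_of_def)

lemma t_mem: "M \<in> basis_multisets B \<Longrightarrow> i \<in> {1..K M} \<Longrightarrow> t M i \<in> basis_monomials \<iota> B M"
  using enum bij_betwE by blast

lemma monomial_cases:
  assumes "M \<in> basis_multisets B" "x \<in> basis_monomials \<iota> B M"
  obtains i where "i \<in> {1..K M}" "x = t M i"
  using assms enum[OF assms(1)] unfolding bij_betw_def by blast

lemma K_eq:
  assumes M: "M \<in> basis_multisets B"
  shows "K M = multinomial_mset M"
proof -
  have monomials: "basis_monomials \<iota> B M = eprod \<iota> ` permutations_of_multiset M"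
    using M by (auto simp: basis_monomials_def basis_multisets_def permutations_of_multiset_def)
  have "permutations_of_multiset M \<subseteq> {w. set w \<subseteq> B}"
    using M by (auto simp: basis_multisets_def permutations_of_multiset_def)
  then have "inj_on (eprod \<iota>) (permutations_of_multiset M)"
    using inj_on_eprod[OF independent_B] inj_on_subset by blast
  then have "card (basis_monomials \<iota> B M) = card (permutations_of_multiset M)"
    unfolding monomials by (rule card_image)
  moreover have "card (basis_monomials \<iota> B M) = K M"
    using bij_betw_same_card[OF enum[OF M]] by simp
  ultimately show ?thesis
    by (simp add: card_permutations_of_multiset multinomial_mset_def)
qed

lemma one_le_K:
  assumes M: "M \<in> basis_multisets B"
  shows "1 \<le> K M"
proof -
  obtain w where "mset w = M" using ex_mset by blast
  with M have "eprod \<iota> w \<in> basis_monomials \<iota> B M"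
    by (auto simp: basis_monomials_def basis_multisets_def)
  with M obtain i where "i \<in> {1..K M}" by (rule monomial_cases)
  then show ?thesis by simp
qed

text \<open>
  Basis monomials of different multisets are different, and so are those with different indices in
  one class; hence \<open>h\<close> can be arbitrary. The unit is the e-product of the empty word.
\<close>

lemma functional_exists:
  "\<exists>\<phi>. Vector_Spaces.linear scaleA (*) \<phi> \<and> \<phi> 1 = c \<and>
     (\<forall>M\<in>basis_multisets B. \<forall>j\<in>{1..K M}. \<phi> (t M j) = h M j)"
proof -
  interpret F: vector_space "(*) :: 'f \<Rightarrow> 'f \<Rightarrow> 'f"
    by unfold_locales (simp_all add: algebra_simps)
  interpret AF: vector_space_pair scaleA "(*) :: 'f \<Rightarrow> 'f \<Rightarrow> 'f" ..
  let ?W = "{w. set w \<subseteq> B}"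
  let ?word = "the_inv_into ?W (eprod \<iota>)"
  let ?g = "\<lambda>x. if ?word x = [] then c
    else h (mset (?word x)) (the_inv_into {1..K (mset (?word x))} (t (mset (?word x))) x)"
  have word: "?word (eprod \<iota> w) = w" if "set w \<subseteq> B" for w
    using that by (intro the_inv_into_f_f inj_on_eprod independent_B) simp
  obtain \<phi> where lin: "Vector_Spaces.linear scaleA (*) \<phi>"
    and \<phi>: "\<And>w. set w \<subseteq> B \<Longrightarrow> \<phi> (eprod \<iota> w) = ?g (eprod \<iota> w)"
    using AF.linear_independent_extend[OF independent_eprod[OF independent_B], of ?g] by blast
  have "\<phi> 1 = c" using \<phi>[of "[]"] word[of "[]"] by (simp add: eprod_def)
  moreover have "\<phi> (t M j) = h M j" if M: "M \<in> basis_multisets B" and j: "j \<in> {1..K M}" for M j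
  proof -
    obtain w where w: "set w \<subseteq> B" "mset w = M" "t M j = eprod \<iota> w"
      using t_mem[OF M j] by (auto simp: basis_monomials_def)
    have "w \<noteq> []" using M w(2) by (auto simp: basis_multisets_def)
    then have "\<phi> (t M j) = h M (the_inv_into {1..K M} (t M) (t M j))"
      using \<phi>[OF w(1)] by (simp add: word[OF w(1)] w)
    also have "\<dots> = h M j"
      using enum[OF M] j by (simp add: the_inv_into_f_f bij_betw_def)
    finally show ?thesis .
  qed
  ultimately show ?thesis using lin by blast
qed

text \<open>
  The functional with value \<open>1\<close> on every e-product of basis vectors kills all differences. Taking
  \<open>x = t M 1\<close>, this shows that removing \<open>t M 1\<close> from its chain removes no difference.
\<close>

lemma first_not_difference:
  assumes "M \<in> basis_multisets B" "1 \<le> i" "i < K M"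
    and "x = 1 \<or> (\<exists>L\<in>basis_multisets B. x = t L 1)"
  shows "t M i - t M (i + 1) \<noteq> x"
proof
  assume eq: "t M i - t M (i + 1) = x"
  obtain \<phi> where "Vector_Spaces.linear scaleA (*) \<phi>" and one: "\<phi> 1 = 1"
    and \<phi>: "\<And>M j. M \<in> basis_multisets B \<Longrightarrow> j \<in> {1..K M} \<Longrightarrow> \<phi> (t M j) = 1"
    using functional_exists[of 1 "\<lambda>_ _. 1"] by blast
  then interpret \<phi>: Vector_Spaces.linear scaleA "(*)" \<phi> by blast
  have "\<phi> x = 0" using assms(1-3) by (simp add: \<phi>.diff \<phi> flip: eq)
  moreover have "\<phi> x = 1" using assms(4) one one_le_K by (auto simp: \<phi>)
  ultimately show False by simp
qed

lemma chain_minus_first: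
  assumes M: "M \<in> basis_multisets B"
  shows "difference_chain (t M) (K M) - {t M 1} = {t M i - t M (i + 1) |i. 1 \<le> i \<and> i < K M}"
  using first_not_difference[OF M, of _ "t M 1"] M unfolding difference_chain_def by auto

lemma difference_in_span:
  assumes M: "M \<in> basis_multisets B"
    and r: "r \<in> basis_monomials \<iota> B M" and s: "s \<in> basis_monomials \<iota> B M"
  shows "r - s \<in> A.span (difference_chain (t M) (K M) - {t M 1})" (is "_ \<in> A.span ?D")
proof -
  obtain i j where i: "i \<in> {1..K M}" "r = t M i" and j: "j \<in> {1..K M}" "s = t M j"
    by (rule monomial_cases[OF M r], rule monomial_cases[OF M s])
  have "t M i - t M (Suc i) \<in> A.span ?D" if "1 \<le> i" "i < K M" for i
    using that unfolding chain_minus_first[OF M] by (intro A.span_base) auto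
  note tel = A.span_telescope[of "K M" "t M", OF this]
  have "(t M 1 - t M j) - (t M 1 - t M i) \<in> A.span ?D"
    by (intro A.span_diff tel i(1) j(1))
  then show ?thesis by (simp add: i(2) j(2))
qed

lemma span_chain:
  assumes M: "M \<in> basis_multisets B"
  shows "A.span (difference_chain (t M) (K M)) = A.span (basis_monomials \<iota> B M)"
    (is "A.span ?C = A.span ?E")
proof -
  have first: "t M 1 \<in> ?E" using t_mem[OF M] one_le_K[OF M] by simp
  have "x \<in> A.span ?C" if "x \<in> ?E" for x
  proof -
    have "x - t M 1 \<in> A.span ?C"
      using difference_in_span[OF M that first] A.span_mono[of "?C - {t M 1}" ?C] by blast
    moreover have "t M 1 \<in> A.span ?C" by (intro A.span_base) (simp add: difference_chain_def)
    ultimately have "(x - t M 1) + t M 1 \<in> A.span ?C" by (rule A.span_add)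
    then show ?thesis by simp
  qed
  moreover have "x \<in> A.span ?E" if "x \<in> ?C" for x
    using that first t_mem[OF M]
    by (auto simp: difference_chain_def intro!: A.span_diff intro: A.span_base)
  ultimately show ?thesis unfolding A.span_eq by blast
qed

definition "differences = (\<Union>M\<in>basis_multisets B. difference_chain (t M) (K M) - {t M 1})"
definition "representatives = (\<Union>M\<in>basis_multisets B. {t M 1}) \<union> {1}"

lemma differences_eq:
  "differences = {t M i - t M (i + 1) |M i. M \<in> basis_multisets B \<and> 1 \<le> i \<and> i < K M}"
proof -
  have "differences = (\<Union>M\<in>basis_multisets B. {t M i - t M (i + 1) |i. 1 \<le> i \<and> i < K M})"
    unfolding differences_def by (intro SUP_cong refl chain_minus_first)
  then show ?thesis by blast
qed

lemma disjoint: "differences \<inter> representatives = {}"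
proof -
  have False if x: "x \<in> differences" "x \<in> representatives" for x
  proof -
    from x(1) obtain M i where M: "M \<in> basis_multisets B" "1 \<le> i" "i < K M"
      and eq: "t M i - t M (i + 1) = x"
      unfolding differences_eq by blast
    from x(2) have "x = 1 \<or> (\<exists>L\<in>basis_multisets B. x = t L 1)"
      unfolding representatives_def by blast
    from first_not_difference[OF M this] eq show False by contradiction
  qed
  then show ?thesis by blast
qed

lemma element_cases [consumes 1, case_names diff rep one]:
  assumes z: "z \<in> differences \<union> representatives"
    and diff: "\<And>M i. M \<in> basis_multisets B \<Longrightarrow> 1 \<le> i \<Longrightarrow> i < K M \<Longrightarrow> z = t M i - t M (i + 1) \<Longrightarrow> P"
    and rep: "\<And>M. M \<in> basis_multisets B \<Longrightarrow> z = t M 1 \<Longrightarrow> P"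
    and one: "z = 1 \<Longrightarrow> P"
  shows P
proof -
  have "z \<in> differences \<or> (\<exists>M\<in>basis_multisets B. z = t M 1) \<or> z = 1"
    using z unfolding representatives_def by auto
  then show P
  proof (elim disjE bexE)
    assume "z \<in> differences"
    then obtain M i where "M \<in> basis_multisets B" "1 \<le> i" "i < K M" "z = t M i - t M (i + 1)"
      unfolding differences_eq by blast
    then show P by (rule diff)
  qed (use rep one in auto)
qed

lemma independent: "A.independent (differences \<union> representatives)"
proof (rule A.independent_if_separated)
  fix z assume "z \<in> differences \<union> representatives"
  \<comment> \<open>Values of a separating functional: \<open>c\<close> on the unit and \<open>h\<close> on the monomials. The last three
    conditions say that it can be nonzero on a member of the family only if that member is \<open>z\<close>.\<close>
  then obtain c h where
      z: "\<And>\<phi>. Vector_Spaces.linear scaleA (*) \<phi> \<Longrightarrow> \<phi> 1 = c \<Longrightarrow>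
        (\<And>M j. M \<in> basis_multisets B \<Longrightarrow> j \<in> {1..K M} \<Longrightarrow> \<phi> (t M j) = h M j) \<Longrightarrow> \<phi> z \<noteq> 0"
    and one_z: "c \<noteq> 0 \<Longrightarrow> z = 1"
    and rep_z: "\<And>L. L \<in> basis_multisets B \<Longrightarrow> h L 1 \<noteq> 0 \<Longrightarrow> z = t L 1"
    and diff_z: "\<And>L j. L \<in> basis_multisets B \<Longrightarrow> 1 \<le> j \<Longrightarrow> j < K L \<Longrightarrow> h L j \<noteq> h L (j + 1) \<Longrightarrow>
        z = t L j - t L (j + 1)"
  proof (cases rule: element_cases)
    case (diff M i)
    show ?thesis
      \<comment> \<open>The indicator of the indices after \<open>i\<close>: that of \<open>{..i}\<close> would not vanish on \<open>t M 1\<close>.\<close>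
    proof (rule that[of 0 "\<lambda>L j. if L = M \<and> i < j then 1 else 0"])
      fix \<phi> assume "Vector_Spaces.linear scaleA (*) \<phi>"
        and \<phi>: "\<And>L j. L \<in> basis_multisets B \<Longrightarrow> j \<in> {1..K L} \<Longrightarrow>
           \<phi> (t L j) = (if L = M \<and> i < j then 1 else 0)"
      then interpret \<phi>: Vector_Spaces.linear scaleA "(*)" \<phi> by blast
      show "\<phi> z \<noteq> 0" using diff by (simp add: \<phi>.diff \<phi>)
    next
      fix L j assume "(if L = M \<and> i < j then 1 else 0 :: 'f) \<noteq> (if L = M \<and> i < j + 1 then 1 else 0)"
      then have "L = M \<and> j = i" by (auto split: if_splits)
      then show "z = t L j - t L (j + 1)" using diff by simp
    qed (use diff in \<open>auto split: if_splits\<close>)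
  next
    case (rep M)
    then show ?thesis
      using one_le_K by (intro that[of 0 "\<lambda>L j. if L = M then 1 else 0"]) (auto split: if_splits)
  next
    case one
    then show ?thesis by (intro that[of 1 "\<lambda>L j. 0"]) auto
  qed
  obtain \<phi> where lin: "Vector_Spaces.linear scaleA (*) \<phi>" and c: "\<phi> 1 = c"
    and h: "\<And>M j. M \<in> basis_multisets B \<Longrightarrow> j \<in> {1..K M} \<Longrightarrow> \<phi> (t M j) = h M j"
    using functional_exists[of c h] by blast
  interpret \<phi>: Vector_Spaces.linear scaleA "(*)" \<phi> by fact
  have "\<phi> y = 0" if "y \<in> differences \<union> representatives - {z}" for y
  proof -
    from that have "y \<in> differences \<union> representatives" by blast
    then show ?thesis
    proof (cases rule: element_cases)
      case (diff L j)
      with that have "h L j = h L (j + 1)" using diff_z[of L j] by auto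
      with diff show ?thesis by (simp add: \<phi>.diff h)
    next
      case (rep L)
      with that have "h L 1 = 0" using rep_z[of L] by auto
      with rep show ?thesis using one_le_K by (simp add: h)
    next
      case one
      with that have "c = 0" using one_z by auto
      with one show ?thesis by (simp add: c)
    qed
  qed
  with z[OF lin c h] lin
  show "\<exists>\<phi>. Vector_Spaces.linear scaleA (*) \<phi> \<and> \<phi> z \<noteq> 0 \<and>
      (\<forall>y\<in>differences \<union> representatives - {z}. \<phi> y = 0)"
    by blast
qed

lemma span_all: "A.span (differences \<union> representatives) = TV" (is "A.span ?X = TV")
proof -
  let ?E = "eprod \<iota> ` {w. set w \<subseteq> B}"
  have tE: "t M i \<in> ?E" if "M \<in> basis_multisets B" "i \<in> {1..K M}" for M i
    using t_mem[OF that] by (auto simp: basis_monomials_def)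
  have "1 \<in> ?E" by (rule image_eqI[of _ _ "[]"]) (simp_all add: eprod_def)
  then have "?X \<subseteq> A.span ?E"
    using tE one_le_K unfolding differences_eq representatives_def
    by (auto intro!: A.span_diff intro: A.span_base)
  moreover have "eprod \<iota> w \<in> A.span ?X" if w: "set w \<subseteq> B" for w
  proof (cases "w = []")
    case True
    then show ?thesis by (intro A.span_base) (simp add: eprod_def representatives_def)
  next
    case False
    with w have M: "mset w \<in> basis_multisets B" by (simp add: basis_multisets_def)
    have "eprod \<iota> w \<in> A.span (basis_monomials \<iota> B (mset w))"
      using w by (intro A.span_base) (auto simp: basis_monomials_def)
    moreover have "difference_chain (t (mset w)) (K (mset w)) \<subseteq> ?X"
      using M unfolding differences_def representatives_def by blast
    ultimately show ?thesis using A.span_mono unfolding span_chain[OF M, symmetric] by blast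
  qed
  ultimately have "A.span ?X = A.span ?E"
    by (intro subset_antisym A.span_minimal A.subspace_span) auto
  then show ?thesis using span_basis_words[OF span_B] by simp
qed

text \<open>
  Two reorderings \<open>u \<noteq> w\<close> have length at least \<open>2\<close>, so the differences in the chains are generators
  of the ideal; the other inclusion is \<open>reordering_in_subspace\<close>.
\<close>

lemma span_differences: "A.span differences = noncomm_ideal scaleA \<iota>"
proof
  let ?G = "{eprod \<iota> u - eprod \<iota> w |u w.
    length u = length w \<and> length u \<ge> 2 \<and> mset u = mset w \<and> u \<noteq> w}"
  have "t M i - t M (i + 1) \<in> ?G" if M: "M \<in> basis_multisets B" and i: "1 \<le> i" "i < K M" for M i
  proof -
    obtain u w where u: "mset u = M" "t M i = eprod \<iota> u"
      and w: "mset w = M" "t M (i + 1) = eprod \<iota> w"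
      using t_mem[OF M, of i] t_mem[OF M, of "i + 1"] i by (auto simp: basis_monomials_def)
    have "t M i \<noteq> t M (i + 1)"
      using inj_on_eq_iff[OF bij_betw_imp_inj_on[OF enum[OF M]], of i "i + 1"] i by simp
    then have ne: "u \<noteq> w" using u w by auto
    have len: "length u = length w" using mset_eq_length[of u w] u(1) w(1) by simp
    have "length u \<ge> 2"
    proof (rule ccontr)
      assume "\<not> length u \<ge> 2"
      then have "length u = 0 \<or> length u = 1" by linarith
      then show False using ne len u(1) w(1)
        by (cases u; cases w) auto
    qed
    moreover have "t M i - t M (i + 1) = eprod \<iota> u - eprod \<iota> w" "mset u = mset w"
      using u w by simp_all
    ultimately show ?thesis using ne len by blast
  qed
  then show "A.span differences \<subseteq> noncomm_ideal scaleA \<iota>"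
    unfolding noncomm_ideal_def differences_eq by (intro A.span_mono) blast
  have "eprod \<iota> u - eprod \<iota> w \<in> A.span differences" if "mset u = mset w" for u w
  proof (rule reordering_in_subspace[OF span_B A.subspace_span _ that])
    fix u w assume uw: "set u \<subseteq> B" "set w \<subseteq> B" "mset u = mset w"
    show "eprod \<iota> u - eprod \<iota> w \<in> A.span differences"
    proof (cases "u = []")
      case True
      with uw show ?thesis by (simp add: A.span_zero)
    next
      case False
      then have M: "mset u \<in> basis_multisets B" using uw(1) by (simp add: basis_multisets_def)
      have "eprod \<iota> u - eprod \<iota> w \<in>
          A.span (difference_chain (t (mset u)) (K (mset u)) - {t (mset u) 1})"
        using uw by (intro difference_in_span[OF M]) (auto simp: basis_monomials_def)
      then show ?thesis
        using M A.span_mono[of _ differences] unfolding differences_def by blast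
    qed
  qed
  then show "noncomm_ideal scaleA \<iota> \<subseteq> A.span differences"
    unfolding noncomm_ideal_def by (intro A.span_minimal A.subspace_span) auto
qed

lemma complementary_representatives:
  "complementary scaleA TV (noncomm_ideal scaleA \<iota>) (A.span representatives)"
  unfolding complementary_def span_differences[symmetric] span_all[symmetric]
  using A.span_Int_span_of_disjoint[OF independent disjoint]
  by (auto simp: A.span_Un A.subspace_span)

end

theorem mainTheorem2:
  fixes scaleV :: "'f::field \<Rightarrow> 'v::ab_group_add \<Rightarrow> 'v"
    and scaleA :: "'f \<Rightarrow> 'a::ring_1 \<Rightarrow> 'a"
    and TV :: "'a set" and \<iota> :: "'v \<Rightarrow> 'a"
    and B :: "'v set"
    and K :: "'v multiset \<Rightarrow> nat"
    and t :: "'v multiset \<Rightarrow> nat \<Rightarrow> 'a"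
  assumes "vector_space scaleV"
    and "tensor_algebra scaleV scaleA TV \<iota>"
    and "basis_of scaleV B UNIV"
    and "\<And>M. M \<in> basis_multisets B \<Longrightarrow> bij_betw (t M) {1..K M} (basis_monomials \<iota> B M)"
  shows "(\<forall>M\<in>basis_multisets B.
            K M = multinomial_mset M \<and>
            module.span scaleA (difference_chain (t M) (K M))
              = module.span scaleA (basis_monomials \<iota> B M) \<and>
            (\<forall>r\<in>basis_monomials \<iota> B M. \<forall>s\<in>basis_monomials \<iota> B M.
               r - s \<in> module.span scaleA (difference_chain (t M) (K M) - {t M 1})))
       \<and> (let A = (\<Union>M\<in>basis_multisets B. difference_chain (t M) (K M) - {t M 1});
              S = (\<Union>M\<in>basis_multisets B. {t M 1}) \<union> {1}
          in basis_of scaleA (A \<union> S) TV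
           \<and> basis_of scaleA A (noncomm_ideal scaleA \<iota>)
           \<and> (\<exists>C. complementary scaleA TV (noncomm_ideal scaleA \<iota>) C \<and> basis_of scaleA S C))"
proof -
  interpret tensor_algebra scaleV scaleA TV \<iota> by fact
  interpret enumerated_monomials scaleV scaleA TV \<iota> B K t
    by unfold_locales (use assms(3,4) in auto)
  have "A.independent differences" "A.independent representatives"
    using A.independent_mono[OF independent] by blast+
  then show ?thesis
    using K_eq span_chain difference_in_span independent span_all span_differences
      complementary_representatives
    unfolding Let_def basis_of_def differences_def[symmetric] representatives_def[symmetric]
    by blast
qed

end
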